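(* Let $S$ be a finite semigroup. The following are equivalent: (i) $S$ is regular; (ii) $\mathbb{Z}\times S$ contains only countably many subdirect products (of $\mathbb{Z}$ and $S$); (iii) $\mathbb{Z}\times S$ contains only countably many subdirect products (of $\mathbb{Z}$ and $S$) up to isomorphism.
   Context: $\mathbb{Z}$ denotes the additive (semi)group of integers, and $\mathbb{Z}\times S$ is the direct product semigroup. For semigroups $A$ and $B$, a subdirect product in $A\times B$ is a subsemigroup $U\leq A\times B$ whose coordinate projections to $A$ and to $B$ are both surjective. A semigroup $S$ is regular if for every $x\in S$ there exists $y\in S$ with $xyx=x$. "Only countably many" means the number is finite or countably infinite; "up to isomorphism" means counting isomorphism classes of the subdirect products regarded as abstract semigroups. *)

theory Defs
  imports "HOL-Algebra.Elementary_Groups" "HOL-Library.Countable_Set"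
begin

text \<open>
  Semigroups are represented by the \<open>monoid\<close> records of HOL-Algebra, so that the direct
  product \<open>\<times>\<times>\<close> and isomorphism \<open>\<cong>\<close> are available.  Nothing is assumed about
  the field \<open>one\<close>, which plays no role: \<open>hom\<close>, \<open>iso\<close> and \<open>\<cong>\<close> refer only to the
  carriers and the multiplications.
\<close>

locale semigroup_struct =
  fixes S (structure)
  assumes m_closed [intro, simp]:
      "\<lbrakk>x \<in> carrier S; y \<in> carrier S\<rbrakk> \<Longrightarrow> x \<otimes> y \<in> carrier S"
    and m_assoc:
      "\<lbrakk>x \<in> carrier S; y \<in> carrier S; z \<in> carrier S\<rbrakk>
        \<Longrightarrow> (x \<otimes> y) \<otimes> z = x \<otimes> (y \<otimes> z)"

definition regular_semigroup :: "('a, 'b) monoid_scheme \<Rightarrow> bool" where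
  "regular_semigroup S \<longleftrightarrow>
     (\<forall>x \<in> carrier S. \<exists>y \<in> carrier S. x \<otimes>\<^bsub>S\<^esub> y \<otimes>\<^bsub>S\<^esub> x = x)"

definition subsemigroup :: "'a set \<Rightarrow> ('a, 'b) monoid_scheme \<Rightarrow> bool" where
  "subsemigroup U S \<longleftrightarrow>
     U \<subseteq> carrier S \<and> (\<forall>x \<in> U. \<forall>y \<in> U. x \<otimes>\<^bsub>S\<^esub> y \<in> U)"

definition subdirect_products ::
    "('a, 'c) monoid_scheme \<Rightarrow> ('b, 'd) monoid_scheme \<Rightarrow> ('a \<times> 'b) set set" where
  "subdirect_products A B =
     {U. subsemigroup U (A \<times>\<times> B) \<and> fst ` U = carrier A \<and> snd ` U = carrier B}"

definition subdirect_iso_rel ::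
    "('a, 'c) monoid_scheme \<Rightarrow> ('b, 'd) monoid_scheme \<Rightarrow> ('a \<times> 'b) set rel" where
  "subdirect_iso_rel A B =
     {(U, V). U \<in> subdirect_products A B \<and> V \<in> subdirect_products A B \<and>
        (A \<times>\<times> B)\<lparr>carrier := U\<rparr> \<cong> (A \<times>\<times> B)\<lparr>carrier := V\<rparr>}"

text \<open>
  Unlike \<open>group.iso_sym\<close>, symmetry of \<open>\<cong>\<close> here only needs closure under multiplication.
\<close>

lemma subsemigroup_iso_sym:
  assumes "subsemigroup U G" and "G\<lparr>carrier := U\<rparr> \<cong> G\<lparr>carrier := V\<rparr>"
  shows "G\<lparr>carrier := V\<rparr> \<cong> G\<lparr>carrier := U\<rparr>"
proof -
  obtain h where hom: "\<And>x y. \<lbrakk>x \<in> U; y \<in> U\<rbrakk> \<Longrightarrow> h (x \<otimes>\<^bsub>G\<^esub> y) = h x \<otimes>\<^bsub>G\<^esub> h y"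
    and bij: "bij_betw h U V"
    using assms(2) by (auto simp: is_iso_def iso_def hom_def)
  let ?k = "inv_into U h"
  have bk: "bij_betw ?k V U" by (rule bij_betw_inv_into[OF bij])
  have kU: "?k v \<in> U" if "v \<in> V" for v using bk that by (auto simp: bij_betw_def)
  have hk: "h (?k v) = v" if "v \<in> V" for v
    using bij that by (rule bij_betw_inv_into_right)
  have "?k (v \<otimes>\<^bsub>G\<^esub> w) = ?k v \<otimes>\<^bsub>G\<^esub> ?k w" if "v \<in> V" "w \<in> V" for v w
  proof -
    have "?k v \<otimes>\<^bsub>G\<^esub> ?k w \<in> U" using assms(1) kU that by (auto simp: subsemigroup_def)
    moreover have "h (?k v \<otimes>\<^bsub>G\<^esub> ?k w) = v \<otimes>\<^bsub>G\<^esub> w" using hom kU hk that by simp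
    ultimately show ?thesis using bij_betw_inv_into_left[OF bij] by metis
  qed
  then have "?k \<in> iso (G\<lparr>carrier := V\<rparr>) (G\<lparr>carrier := U\<rparr>)"
    using bk kU by (auto simp: iso_def hom_def)
  then show ?thesis by (rule is_isoI)
qed

lemma equiv_subdirect_iso_rel: "equiv (subdirect_products A B) (subdirect_iso_rel A B)"
proof (rule equivI)
  show "subdirect_iso_rel A B \<subseteq> subdirect_products A B \<times> subdirect_products A B"
    by (auto simp: subdirect_iso_rel_def)
  show "refl_on (subdirect_products A B) (subdirect_iso_rel A B)"
    by (auto simp: subdirect_iso_rel_def refl_on_def)
  show "sym (subdirect_iso_rel A B)"
    by (auto simp: subdirect_iso_rel_def sym_def subdirect_products_def
        intro: subsemigroup_iso_sym)
  show "trans (subdirect_iso_rel A B)"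
    by (auto simp: subdirect_iso_rel_def trans_def intro: iso_trans)
qed

end

(*
  If S is regular, each fibre over S of a subdirect product of Z and S is a singleton or is
  invariant under a nonzero translation, hence a finite union of arithmetic progressions; so a
  subdirect product is described by finitely many integers and elements of S.

  If x is not regular, let J be its J-class and I the ideal of all s with x not in S^1 s S^1.
  Then J J is contained in I, so (Z x I) Un (X x J) Un ({0} x S) is a subdirect product for every
  set X of integers.
  A homomorphism from a subdirect product containing Z x {f} to Z is a multiple of the first
  projection, because each (0, t) has finitely many powers and (n, s)(-n, f) = (0, s f).  Hence
  an isomorphism changes first coordinates at most by a sign, and the cardinalities of the fibres
  over Z recover X - {0} up to sign.
*)

theory Submission
  imports Defs
begin

section \<open>Regular semigroups\<close>

text \<open>Closure under successor makes \<open>A\<close> an up-set. If it is neither empty nor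
  everything, descent from a member must leave \<open>A\<close>, and the last member reached is the
  minimum.\<close>

lemma int_up_closed_cases:
  fixes A :: "int set"
  assumes up: "\<And>j. j \<in> A \<Longrightarrow> j + 1 \<in> A"
  obtains "A = {}" | "A = UNIV" | k where "A = {k..}"
proof (cases "A = {} \<or> A = UNIV")
  case True
  then show thesis using that by blast
next
  case False
  have up': "j \<in> A" if "i \<in> A" "i \<le> j" for i j
    using that(2) by (induction rule: int_ge_induct) (use that(1) up in auto)
  obtain y b where y: "y \<in> A" and b: "b \<notin> A" using False by blast
  have "\<exists>k\<in>A. k - 1 \<notin> A"
  proof (rule ccontr)
    assume neg: "\<not> (\<exists>k\<in>A. k - 1 \<notin> A)"
    have "j \<in> A" if "j \<le> y" for j
      using that by (induction rule: int_le_induct) (use y neg in auto)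
    moreover have "b \<le> y" using up' y b by (meson nle_le)
    ultimately show False using b by blast
  qed
  then obtain k where k: "k \<in> A" "k - 1 \<notin> A" by blast
  have "A = {k..}" using up'[of _ "k - 1"] up'[of k] k by force
  then show thesis using that by blast
qed

text \<open>The index runs over \<open>nat\<close> while the difference may have either sign, so a
  half-line is one progression and the set of all integers is a union of two.\<close>

lemma int_up_closed_progressions:
  fixes A :: "int set"
  assumes "\<And>j. j \<in> A \<Longrightarrow> j + 1 \<in> A"
  obtains F :: "(int \<times> int) set"
  where "finite F" "A = (\<Union>(k, a)\<in>F. range (\<lambda>i::nat. k + a * int i))"
proof -
  consider "A = {}" | "A = UNIV" | k where "A = {k..}"
    using int_up_closed_cases[of A] assms by blast
  then show thesis
  proof cases
    case 1
    then show thesis using that[of "{}"] by simp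
  next
    case 2
    have "x \<in> range (\<lambda>i::nat. 0 + 1 * int i) \<union> range (\<lambda>i::nat. 0 + (-1) * int i)" for x
    proof (cases "x \<ge> 0")
      case True
      then have "x = 0 + 1 * int (nat x)" by simp
      then show ?thesis by blast
    next
      case False
      then have "x = 0 + (-1) * int (nat (- x))" by simp
      then show ?thesis by blast
    qed
    then have "A = (\<Union>(k, a)\<in>{(0, 1), (0, -1)}. range (\<lambda>i::nat. k + a * int i))"
      unfolding 2 by (intro equalityI subsetI) (simp_all del: Un_iff add: Un_commute)
    then show thesis by (rule that[rotated]) simp
  next
    case (3 k)
    have "x \<in> range (\<lambda>i::nat. k + 1 * int i)" if "x \<ge> k" for x
    proof -
      have "x = k + 1 * int (nat (x - k))" using that by simp
      then show ?thesis by blast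
    qed
    then have "A = (\<Union>(k, a)\<in>{(k, 1)}. range (\<lambda>i::nat. k + a * int i))"
      using 3 by auto
    then show thesis by (rule that[rotated]) simp
  qed
qed

text \<open>Within a residue class modulo \<open>m\<close>, translation by \<open>m\<close> is the
  successor map on the quotient \<open>j\<close>, so the previous lemma handles each of the finitely
  many classes that meet \<open>X\<close>.\<close>

lemma shift_closed_progressions:
  fixes X :: "int set"
  assumes m: "m \<noteq> 0" and shift: "\<And>n. n \<in> X \<Longrightarrow> n + m \<in> X"
  obtains F :: "(int \<times> int) set"
  where "finite F" "X = (\<Union>(k, a)\<in>F. range (\<lambda>i::nat. k + a * int i))"
proof -
  define A where "A r = {j. r + m * j \<in> X}" for r
  have "\<exists>F. finite F \<and> A r = (\<Union>(k, a)\<in>F. range (\<lambda>i::nat. k + a * int i))" for r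
  proof -
    have "j + 1 \<in> A r" if "j \<in> A r" for j
      using shift[of "r + m * j"] that by (simp add: A_def algebra_simps)
    then show ?thesis using int_up_closed_progressions by metis
  qed
  then obtain F :: "int \<Rightarrow> (int \<times> int) set" where F: "\<And>r. finite (F r)"
    "\<And>r. A r = (\<Union>(k, a)\<in>F r. range (\<lambda>i::nat. k + a * int i))"
    by metis
  define R where "R = (\<lambda>n. n mod m) ` X"
  \<comment> \<open>For negative \<open>m\<close> the residues are nonpositive; the symmetric
    interval covers both signs.\<close>
  have "R \<subseteq> {- \<bar>m\<bar>..\<bar>m\<bar>}"
  proof -
    have "\<bar>n mod m\<bar> \<le> \<bar>m\<bar>" for n using m abs_mod_less[of m n] by linarith
    then show ?thesis unfolding R_def by (auto simp: abs_le_iff minus_le_iff)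
  qed
  then have finR: "finite R" using finite_subset by blast
  \<comment> \<open>Substituting j = k + a i into r + m j gives start r + m k and difference m
    a.\<close>
  define G where "G = (\<Union>r\<in>R. (\<lambda>(k, a). (r + m * k, m * a)) ` F r)"
  have XA: "X = (\<Union>r\<in>R. (\<lambda>j. r + m * j) ` A r)"
  proof
    show "X \<subseteq> (\<Union>r\<in>R. (\<lambda>j. r + m * j) ` A r)"
    proof
      fix n assume n: "n \<in> X"
      have "n = n mod m + m * (n div m)" by simp
      moreover have "n div m \<in> A (n mod m)" using n by (simp add: A_def)
      ultimately show "n \<in> (\<Union>r\<in>R. (\<lambda>j. r + m * j) ` A r)"
        using n unfolding R_def by blast
    qed
  qed (auto simp: A_def)
  have finG: "finite G" unfolding G_def using finR F(1) by blast
  have "(\<lambda>j. r + m * j) ` A r =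
      (\<Union>(k, a)\<in>(\<lambda>(k, a). (r + m * k, m * a)) ` F r. range (\<lambda>i::nat. k + a * int i))" for r
    unfolding F(2) by (simp add: image_UN image_image case_prod_beta algebra_simps)
  then have "X = (\<Union>(k, a)\<in>G. range (\<lambda>i::nat. k + a * int i))"
    unfolding G_def by (subst XA) simp
  then show thesis by (rule that[OF finG])
qed

text \<open>
  If \<open>s = s \<otimes> y \<otimes> s\<close> and \<open>e = s \<otimes> y\<close>, the fibre of \<open>U\<close> over \<open>s\<close> is invariant under
  translation by every element of the fibre over \<open>e\<close>, and it is a translate of a subset of that
  fibre; so it is a singleton when the fibre over \<open>e\<close> has no nonzero element.
\<close>

lemma regular_fibre_progressions:
  assumes S: "semigroup_struct S" and reg: "regular_semigroup S"
    and U: "U \<in> subdirect_products integer_group S" and s: "s \<in> carrier S"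
  shows "\<exists>F :: (int \<times> int) set. finite F \<and>
    {n. (n, s) \<in> U} = (\<Union>(k, a)\<in>F. range (\<lambda>i::nat. k + a * int i))"
proof -
  interpret semigroup_struct S by (rule S)
  have closed: "(m + n, t \<otimes>\<^bsub>S\<^esub> u) \<in> U" if "(m, t) \<in> U" "(n, u) \<in> U" for m n t u
    using U that by (force simp: subdirect_products_def subsemigroup_def)
  obtain y where y: "y \<in> carrier S" "s \<otimes>\<^bsub>S\<^esub> y \<otimes>\<^bsub>S\<^esub> s = s"
    using reg s by (auto simp: regular_semigroup_def)
  let ?e = "s \<otimes>\<^bsub>S\<^esub> y"
  obtain c where c: "(c, y) \<in> U"
    using U y(1) by (force simp: subdirect_products_def)
  show ?thesis
  proof (cases "\<exists>m. m \<noteq> 0 \<and> (m, ?e) \<in> U")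
    case True
    then obtain m where m: "m \<noteq> 0" "(m, ?e) \<in> U" by blast
    have "n + m \<in> {n. (n, s) \<in> U}" if "n \<in> {n. (n, s) \<in> U}" for n
      using closed[OF m(2), of n s] that y(2) by (simp add: add.commute)
    then show ?thesis using shift_closed_progressions[OF m(1)] by metis
  next
    case False
    \<comment> \<open>Right multiplication by (c, y) sends (n, s) to (n + c, \<open>?e\<close>), and
      over \<open>?e\<close> only 0 can occur.\<close>
    have sub: "{n. (n, s) \<in> U} \<subseteq> {- c}"
    proof
      fix n assume "n \<in> {n. (n, s) \<in> U}"
      then have "(n + c, ?e) \<in> U" using closed c by blast
      then have "n + c = 0" using False by blast
      then show "n \<in> {- c}" by simp
    qed
    \<comment> \<open>Difference 0 turns a point into a constant progression.\<close>
    have "finite ((\<lambda>n. (n, 0::int)) ` {n. (n, s) \<in> U})"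
      using finite_subset[OF sub] by simp
    moreover have "{n. (n, s) \<in> U} =
      (\<Union>(k, a)\<in>(\<lambda>n. (n, 0)) ` {n. (n, s) \<in> U}. range (\<lambda>i::nat. k + a * int i))"
      by auto
    ultimately show ?thesis by blast
  qed
qed

text \<open>One finite set of triples (start, difference, element of \<open>S\<close>) encodes all
  fibres at once, and a countable set has only countably many finite subsets. It suffices that the
  decoding \<open>D\<close> reaches every subdirect product; its other values do no harm.\<close>

lemma regular_imp_countable_subdirect_products:
  assumes S: "semigroup_struct S" and fin: "finite (carrier S)" and reg: "regular_semigroup S"
  shows "countable (subdirect_products integer_group S)"
proof -
  define D where "D F = (\<Union>(k, a, s)\<in>F. range (\<lambda>i::nat. (k + a * int i, s)))"
    for F :: "(int \<times> int \<times> 'a) set"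
  let ?C = "{F. finite F \<and> F \<subseteq> (UNIV :: int set) \<times> (UNIV :: int set) \<times> carrier S}"
  have sub: "subdirect_products integer_group S \<subseteq> D ` ?C"
  proof
    fix U assume U: "U \<in> subdirect_products integer_group S"
    obtain F :: "'a \<Rightarrow> (int \<times> int) set" where F: "\<And>s. s \<in> carrier S \<Longrightarrow> finite (F s)"
      "\<And>s. s \<in> carrier S \<Longrightarrow>
        {n. (n, s) \<in> U} = (\<Union>(k, a)\<in>F s. range (\<lambda>i::nat. k + a * int i))"
      using regular_fibre_progressions[OF S reg U] by metis
    define G where "G = (\<Union>s\<in>carrier S. (\<lambda>(k, a). (k, a, s)) ` F s)"
    have US: "s \<in> carrier S" if "(n, s) \<in> U" for n s
      using U that by (force simp: subdirect_products_def subsemigroup_def)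
    have "(n, s) \<in> U \<longleftrightarrow> (n, s) \<in> D G" for n s
    proof -
      have "(n, s) \<in> D G \<longleftrightarrow> s \<in> carrier S \<and>
          n \<in> (\<Union>(k, a)\<in>F s. range (\<lambda>i::nat. k + a * int i))"
      proof -
        have "(k, a, s) \<in> G \<longleftrightarrow> s \<in> carrier S \<and> (k, a) \<in> F s" for k a
          unfolding G_def by force
        then show ?thesis unfolding D_def by fastforce
      qed
      also have "\<dots> \<longleftrightarrow> s \<in> carrier S \<and> (n, s) \<in> U"
        using F(2) by blast
      finally show ?thesis using US by blast
    qed
    then have "U = D G" by auto
    moreover have "G \<in> ?C" using fin F(1) by (auto simp: G_def)
    ultimately show "U \<in> D ` ?C" by blast
  qed
  have "countable ?C"
    by (intro countable_Collect_finite_subset countable_SIGMA) (auto simp: fin countable_finite)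
  then show ?thesis by (rule countable_subset[OF sub countable_image])
qed

section \<open>The J-class of a non-regular element\<close>

text \<open>Iterating the equation gives a^k x b^k = x for all k, and by the pigeonhole principle
  two of the elements x b^k coincide.\<close>

lemma (in monoid) finite_left_recurrence:
  assumes fin: "finite (carrier G)"
    and cl: "a \<in> carrier G" "b \<in> carrier G" "x \<in> carrier G" and eq: "a \<otimes> x \<otimes> b = x"
  obtains k :: nat where "k > 0" "a [^] k \<otimes> x = x"
proof -
  have pow: "a [^] k \<otimes> (x \<otimes> b [^] k) = x" for k :: nat
  proof (induction k)
    case (Suc k)
    have "a [^] Suc k \<otimes> (x \<otimes> b [^] Suc k) = a [^] k \<otimes> (a \<otimes> x \<otimes> b) \<otimes> b [^] k"
      using cl nat_pow_Suc2[of b k] by (simp add: m_assoc)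
    then show ?case using Suc cl by (simp add: eq m_assoc)
  qed (use cl in simp)
  have "finite (range (\<lambda>k::nat. x \<otimes> b [^] k))"
    by (rule finite_subset[OF _ fin]) (use cl in auto)
  then have "\<not> inj (\<lambda>k::nat. x \<otimes> b [^] k)"
    using finite_imageD by fastforce
  then obtain i j :: nat where ij: "i < j" "x \<otimes> b [^] i = x \<otimes> b [^] j"
    unfolding inj_def by (metis nat_neq_iff)
  \<comment> \<open>The factor \<open>x\<close> is expanded by \<open>pow\<close> at
    \<open>i\<close>, then \<open>b [^] i\<close> is exchanged for \<open>b [^] j\<close>, so that
    \<open>pow\<close> at \<open>j\<close> contracts the result.\<close>
  have "a [^] (j - i) \<otimes> x = a [^] (j - i) \<otimes> (a [^] i \<otimes> (x \<otimes> b [^] j))"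
    using pow[of i] ij(2) by simp
  also have "\<dots> = a [^] (j - i + i) \<otimes> (x \<otimes> b [^] j)"
    using cl by (simp add: m_assoc[symmetric] nat_pow_mult)
  also have "\<dots> = x" using pow[of j] ij(1) by simp
  finally show thesis using that[of "j - i"] ij(1) by simp
qed

text \<open>Mirror image of the previous argument, with the pigeonhole principle applied to the
  elements a^k x.\<close>

lemma (in monoid) finite_right_recurrence:
  assumes fin: "finite (carrier G)"
    and cl: "a \<in> carrier G" "b \<in> carrier G" "x \<in> carrier G" and eq: "a \<otimes> x \<otimes> b = x"
  obtains k :: nat where "k > 0" "x \<otimes> b [^] k = x"
proof -
  have pow: "a [^] k \<otimes> x \<otimes> b [^] k = x" for k :: nat
  proof (induction k)
    case (Suc k)
    have "a [^] Suc k \<otimes> x \<otimes> b [^] Suc k = a [^] k \<otimes> (a \<otimes> x \<otimes> b) \<otimes> b [^] k"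
      using cl nat_pow_Suc2[of b k] by (simp add: m_assoc)
    then show ?case using Suc cl by (simp add: eq m_assoc)
  qed (use cl in simp)
  have "finite (range (\<lambda>k::nat. a [^] k \<otimes> x))"
    by (rule finite_subset[OF _ fin]) (use cl in auto)
  then have "\<not> inj (\<lambda>k::nat. a [^] k \<otimes> x)"
    using finite_imageD by fastforce
  then obtain i j :: nat where ij: "i < j" "a [^] i \<otimes> x = a [^] j \<otimes> x"
    unfolding inj_def by (metis nat_neq_iff)
  have "x \<otimes> b [^] (j - i) = a [^] j \<otimes> x \<otimes> b [^] i \<otimes> b [^] (j - i)"
    using pow[of i] ij(2) by simp
  also have "\<dots> = a [^] j \<otimes> x \<otimes> b [^] (i + (j - i))"
    using cl by (simp add: m_assoc nat_pow_mult)
  also have "\<dots> = x" using pow[of j] ij(1) by simp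
  finally show thesis using that[of "j - i"] ij(1) by simp
qed

text \<open>Right recurrence for x = p x (q x r) gives x = x (q x r)^k. As k > 0, one factor splits
  off and leaves x = (x q) x (...). Left recurrence now gives x = (x q)^l x with l > 0, and
  splitting off one x q exhibits the inner factor \<open>y\<close>.\<close>

lemma (in monoid) finite_regular_if_factors_twice:
  assumes fin: "finite (carrier G)"
    and cl: "p \<in> carrier G" "q \<in> carrier G" "r \<in> carrier G" "x \<in> carrier G"
    and eq: "p \<otimes> x \<otimes> q \<otimes> x \<otimes> r = x"
  shows "\<exists>y\<in>carrier G. x \<otimes> y \<otimes> x = x"
proof -
  let ?w = "q \<otimes> x \<otimes> r"
  have "p \<otimes> x \<otimes> ?w = x" using eq cl by (simp add: m_assoc)
  then obtain k :: nat where k: "k > 0" "x \<otimes> ?w [^] k = x"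
    using finite_right_recurrence[OF fin, of p ?w x] cl by auto
  obtain k' where k': "k = Suc k'" using k(1) gr0_implies_Suc by blast
  have "(x \<otimes> q) \<otimes> x \<otimes> (r \<otimes> ?w [^] k') = x"
    using k(2) cl unfolding k' by (subst (asm) nat_pow_Suc2) (auto simp: m_assoc)
  then obtain l :: nat where l: "l > 0" "(x \<otimes> q) [^] l \<otimes> x = x"
    using finite_left_recurrence[OF fin, of "x \<otimes> q" "r \<otimes> ?w [^] k'" x] cl by auto
  obtain l' where l': "l = Suc l'" using l(1) gr0_implies_Suc by blast
  have "x \<otimes> (q \<otimes> (x \<otimes> q) [^] l') \<otimes> x = x"
    using l(2) cl unfolding l' by (subst (asm) nat_pow_Suc2) (auto simp: m_assoc)
  then show ?thesis using cl by blast
qed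

section \<open>Adjoining an identity and the J-order\<close>

fun option_mult :: "('a \<Rightarrow> 'a \<Rightarrow> 'a) \<Rightarrow> 'a option \<Rightarrow> 'a option \<Rightarrow> 'a option" where
  "option_mult f None v = v"
| "option_mult f u None = u"
| "option_mult f (Some a) (Some b) = Some (f a b)"

lemma option_mult_None_right [simp]: "option_mult f u None = u"
  by (cases u) auto

text \<open>A version of S^1 in which a new identity \<open>None\<close> is adjoined even if
  \<open>S\<close> already has one. It makes principal ideals expressible by two-sided products and
  the monoid lemmas above applicable.\<close>

definition adjoin_one :: "('a, 'b) monoid_scheme \<Rightarrow> 'a option monoid" where
  "adjoin_one S = \<lparr>carrier = insert None (Some ` carrier S), mult = option_mult (mult S), one = None\<rparr>"

lemma monoid_adjoin_one:
  assumes "semigroup_struct S"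
  shows "monoid (adjoin_one S)"
proof -
  interpret semigroup_struct S by (rule assms)
  show ?thesis
    by (rule monoidI) (auto simp: adjoin_one_def m_assoc)
qed

text \<open>If a product of two elements of the J-class of \<open>x\<close> stayed outside
  \<open>I\<close>, then \<open>x\<close> would factor through two copies of itself, which forces
  regularity of \<open>x\<close> in a finite monoid.\<close>

lemma nonregular_ideal:
  assumes S: "semigroup_struct S" and fin: "finite (carrier S)"
    and nonreg: "\<not> regular_semigroup S"
  obtains I J where "I \<subseteq> carrier S" "J \<subseteq> carrier S" "I \<inter> J = {}" "I \<noteq> {}" "J \<noteq> {}"
    and "\<forall>s\<in>I. \<forall>t\<in>carrier S. s \<otimes>\<^bsub>S\<^esub> t \<in> I \<and> t \<otimes>\<^bsub>S\<^esub> s \<in> I"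
    and "\<forall>s\<in>J. \<forall>t\<in>carrier S. s \<otimes>\<^bsub>S\<^esub> t \<in> I \<union> J \<and> t \<otimes>\<^bsub>S\<^esub> s \<in> I \<union> J"
    and "\<forall>s\<in>J. \<forall>t\<in>J. s \<otimes>\<^bsub>S\<^esub> t \<in> I"
proof -
  interpret semigroup_struct S by (rule S)
  let ?M = "adjoin_one S"
  interpret M: monoid ?M by (rule monoid_adjoin_one[OF S])
  have finM: "finite (carrier ?M)" by (simp add: adjoin_one_def fin)
  have Some_cl [simp]: "Some s \<in> carrier ?M" if "s \<in> carrier S" for s
    using that by (simp add: adjoin_one_def)
  have Some_mult: "Some (s \<otimes>\<^bsub>S\<^esub> t) = Some s \<otimes>\<^bsub>?M\<^esub> Some t" for s t
    by (simp add: adjoin_one_def)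
  obtain x where x: "x \<in> carrier S"
    and nox: "\<And>y. y \<in> carrier S \<Longrightarrow> x \<otimes>\<^bsub>S\<^esub> y \<otimes>\<^bsub>S\<^esub> x \<noteq> x"
    using nonreg by (auto simp: regular_semigroup_def)
  \<comment> \<open>The new identity is no new witness: x x = x would give x x x = x, with
    \<open>x\<close> itself as a witness in \<open>S\<close>.\<close>
  have noxM: "Some x \<otimes>\<^bsub>?M\<^esub> y \<otimes>\<^bsub>?M\<^esub> Some x \<noteq> Some x" if y: "y \<in> carrier ?M" for y
  proof
    assume eq: "Some x \<otimes>\<^bsub>?M\<^esub> y \<otimes>\<^bsub>?M\<^esub> Some x = Some x"
    show False
    proof (cases y)
      case None
      then have "x \<otimes>\<^bsub>S\<^esub> x = x" using eq by (simp add: adjoin_one_def)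
      then show False using nox[OF x] by simp
    next
      case (Some z)
      then show False using eq y nox[of z] by (auto simp: adjoin_one_def)
    qed
  qed
  \<comment> \<open>The J-order of the monoid: \<open>u\<close> lies in the principal ideal
    generated by \<open>v\<close>.\<close>
  define below where "below u v \<longleftrightarrow>
      (\<exists>p\<in>carrier ?M. \<exists>q\<in>carrier ?M. u = p \<otimes>\<^bsub>?M\<^esub> v \<otimes>\<^bsub>?M\<^esub> q)" for u v
  have below_left: "below u v" if "below u (t \<otimes>\<^bsub>?M\<^esub> v)" "t \<in> carrier ?M" "v \<in> carrier ?M" for u v t
    using that unfolding below_def by (metis M.m_assoc M.m_closed)
  have below_right: "below u v" if uv: "below u (v \<otimes>\<^bsub>?M\<^esub> t)" and "t \<in> carrier ?M" "v \<in> carrier ?M" for u v t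
  proof -
    obtain p q where pq: "p \<in> carrier ?M" "q \<in> carrier ?M" "u = p \<otimes>\<^bsub>?M\<^esub> (v \<otimes>\<^bsub>?M\<^esub> t) \<otimes>\<^bsub>?M\<^esub> q"
      using uv unfolding below_def by blast
    then have "u = p \<otimes>\<^bsub>?M\<^esub> v \<otimes>\<^bsub>?M\<^esub> (t \<otimes>\<^bsub>?M\<^esub> q)" using that by (simp add: M.m_assoc)
    then show ?thesis unfolding below_def using pq that by blast
  qed
  have mult_left: "below (t \<otimes>\<^bsub>?M\<^esub> u) v"
    if uv: "below u v" and "t \<in> carrier ?M" "v \<in> carrier ?M" for t u v
  proof -
    obtain p q where pq: "p \<in> carrier ?M" "q \<in> carrier ?M" "u = p \<otimes>\<^bsub>?M\<^esub> v \<otimes>\<^bsub>?M\<^esub> q"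
      using uv unfolding below_def by blast
    then have "t \<otimes>\<^bsub>?M\<^esub> u = (t \<otimes>\<^bsub>?M\<^esub> p) \<otimes>\<^bsub>?M\<^esub> v \<otimes>\<^bsub>?M\<^esub> q" using that by (simp add: M.m_assoc)
    then show ?thesis unfolding below_def using pq that by blast
  qed
  have mult_right: "below (u \<otimes>\<^bsub>?M\<^esub> t) v"
    if uv: "below u v" and "t \<in> carrier ?M" "v \<in> carrier ?M" for t u v
  proof -
    obtain p q where pq: "p \<in> carrier ?M" "q \<in> carrier ?M" "u = p \<otimes>\<^bsub>?M\<^esub> v \<otimes>\<^bsub>?M\<^esub> q"
      using uv unfolding below_def by blast
    then have "u \<otimes>\<^bsub>?M\<^esub> t = p \<otimes>\<^bsub>?M\<^esub> v \<otimes>\<^bsub>?M\<^esub> (q \<otimes>\<^bsub>?M\<^esub> t)" using that by (simp add: M.m_assoc)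
    then show ?thesis unfolding below_def using pq that by blast
  qed
  define I where "I = {s \<in> carrier S. \<not> below (Some x) (Some s)}"
  define J where "J = {s \<in> carrier S. below (Some x) (Some s) \<and> below (Some s) (Some x)}"
  have JJ: "s \<otimes>\<^bsub>S\<^esub> t \<in> I" if s: "s \<in> J" and t: "t \<in> J" for s t
  proof (rule ccontr)
    assume "s \<otimes>\<^bsub>S\<^esub> t \<notin> I"
    then have "below (Some x) (Some s \<otimes>\<^bsub>?M\<^esub> Some t)"
      using s t by (simp add: I_def J_def Some_mult[symmetric])
    then obtain a b where ab: "a \<in> carrier ?M" "b \<in> carrier ?M"
      "Some x = a \<otimes>\<^bsub>?M\<^esub> (Some s \<otimes>\<^bsub>?M\<^esub> Some t) \<otimes>\<^bsub>?M\<^esub> b"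
      unfolding below_def by blast
    obtain u v where uv: "u \<in> carrier ?M" "v \<in> carrier ?M" "Some s = u \<otimes>\<^bsub>?M\<^esub> Some x \<otimes>\<^bsub>?M\<^esub> v"
      using s unfolding J_def below_def by blast
    obtain c d where cd: "c \<in> carrier ?M" "d \<in> carrier ?M" "Some t = c \<otimes>\<^bsub>?M\<^esub> Some x \<otimes>\<^bsub>?M\<^esub> d"
      using t unfolding J_def below_def by blast
    have "(a \<otimes>\<^bsub>?M\<^esub> u) \<otimes>\<^bsub>?M\<^esub> Some x \<otimes>\<^bsub>?M\<^esub> (v \<otimes>\<^bsub>?M\<^esub> c) \<otimes>\<^bsub>?M\<^esub> Some x \<otimes>\<^bsub>?M\<^esub> (d \<otimes>\<^bsub>?M\<^esub> b) = Some x"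
      using ab uv cd x by (simp add: M.m_assoc)
    then have "\<exists>y\<in>carrier ?M. Some x \<otimes>\<^bsub>?M\<^esub> y \<otimes>\<^bsub>?M\<^esub> Some x = Some x"
      using M.finite_regular_if_factors_twice[OF finM] ab uv cd x by (metis M.m_closed Some_cl)
    then show False using noxM by blast
  qed
  have "below (Some x) (Some x)"
    unfolding below_def using x by (metis M.l_one M.one_closed M.r_one Some_cl)
  then have xJ: "x \<in> J" by (simp add: J_def x)
  have ideal: "s \<otimes>\<^bsub>S\<^esub> t \<in> I" "t \<otimes>\<^bsub>S\<^esub> s \<in> I" if "s \<in> I" "t \<in> carrier S" for s t
    using that below_right[of "Some x" "Some s" "Some t"] below_left[of "Some x" "Some t" "Some s"]
    by (auto simp: I_def Some_mult)
  \<comment> \<open>Such products remain below \<open>x\<close>; whether \<open>x\<close> is also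
    below them decides between \<open>J\<close> and \<open>I\<close>.\<close>
  have JS: "s \<otimes>\<^bsub>S\<^esub> t \<in> I \<union> J" "t \<otimes>\<^bsub>S\<^esub> s \<in> I \<union> J" if "s \<in> J" "t \<in> carrier S" for s t
    using that x mult_right[of "Some s" "Some x" "Some t"] mult_left[of "Some s" "Some x" "Some t"]
    by (auto simp: I_def J_def Some_mult)
  have "I \<subseteq> carrier S" "J \<subseteq> carrier S" "I \<inter> J = {}" by (auto simp: I_def J_def)
  \<comment> \<open>The square of \<open>x\<close> is an element of \<open>I\<close>.\<close>
  moreover have "I \<noteq> {}" "J \<noteq> {}" using JJ[OF xJ xJ] xJ by auto
  ultimately show thesis using ideal JS JJ by (intro that[of I J]) auto
qed

section \<open>Homomorphisms to the integers\<close>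

text \<open>Squaring doubles the value, so the largest value is at most 0 and the smallest is at
  least 0.\<close>

lemma finite_semigroup_int_hom_eq_zero:
  fixes \<phi> :: "'a \<Rightarrow> int"
  assumes fin: "finite T" and cl: "\<And>s t. s \<in> T \<Longrightarrow> t \<in> T \<Longrightarrow> f s t \<in> T"
    and hom: "\<And>s t. s \<in> T \<Longrightarrow> t \<in> T \<Longrightarrow> \<phi> (f s t) = \<phi> s + \<phi> t" and t: "t \<in> T"
  shows "\<phi> t = 0"
proof -
  have img: "finite (\<phi> ` T)" "\<phi> ` T \<noteq> {}" using fin t by auto
  obtain a where a: "a \<in> T" "\<phi> a = Max (\<phi> ` T)" using Max_in[OF img] by fastforce
  obtain b where b: "b \<in> T" "\<phi> b = Min (\<phi> ` T)" using Min_in[OF img] by fastforce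
  have "\<phi> (f a a) \<le> \<phi> a" using Max_ge[OF img(1)] cl[OF a(1) a(1)] a(2) by simp
  moreover have "\<phi> b \<le> \<phi> (f b b)" using Min_le[OF img(1)] cl[OF b(1) b(1)] b(2) by simp
  moreover have "\<phi> (f a a) = \<phi> a + \<phi> a" "\<phi> (f b b) = \<phi> b + \<phi> b" using hom a b by auto
  moreover have "\<phi> t \<le> \<phi> a" "\<phi> b \<le> \<phi> t" using a b img t by auto
  ultimately show ?thesis by linarith
qed

lemma int_additive_eq_mult:
  fixes \<psi> :: "int \<Rightarrow> int"
  assumes add: "\<And>m n. \<psi> (m + n) = \<psi> m + \<psi> n"
  shows "\<psi> n = \<psi> 1 * n"
proof (induction n rule: int_induct[where k = 0])
  case base
  show ?case using add[of 0 0] by simp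
next
  case (step1 i)
  then show ?case using add[of i 1] by (simp add: algebra_simps)
next
  case (step2 i)
  then show ?case using add[of "i - 1" 1] by (simp add: algebra_simps)
qed

lemma subdirect_int_hom_eq_mult_fst:
  fixes \<phi> :: "int \<times> 'a \<Rightarrow> int"
  assumes fin: "finite (carrier S)" and U: "U \<in> subdirect_products integer_group S"
    and f: "UNIV \<times> {f} \<subseteq> U"
    and hom: "\<And>u v. u \<in> U \<Longrightarrow> v \<in> U \<Longrightarrow> \<phi> (u \<otimes>\<^bsub>integer_group \<times>\<times> S\<^esub> v) = \<phi> u + \<phi> v"
  shows "\<exists>c. \<forall>u\<in>U. \<phi> u = c * fst u"
proof -
  have sub: "U \<subseteq> UNIV \<times> carrier S"
    using U by (auto simp: subdirect_products_def subsemigroup_def)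
  have closed: "(m + n, t \<otimes>\<^bsub>S\<^esub> u) \<in> U" if "(m, t) \<in> U" "(n, u) \<in> U" for m n t u
    using U that by (force simp: subdirect_products_def subsemigroup_def)
  have hom': "\<phi> (m + n, t \<otimes>\<^bsub>S\<^esub> u) = \<phi> (m, t) + \<phi> (n, u)" if "(m, t) \<in> U" "(n, u) \<in> U" for m n t u
    using hom[OF that] by simp
  define T where "T = {t. (0, t) \<in> U}"
  have zero: "\<phi> (0, t) = 0" if "(0, t) \<in> U" for t
  proof (rule finite_semigroup_int_hom_eq_zero[where T = T and f = "mult S" and \<phi> = "\<lambda>t. \<phi> (0, t)"])
    show "finite T" using finite_subset[OF _ fin, of T] sub by (auto simp: T_def)
  qed (use that closed[of 0 _ 0] hom'[of 0 _ 0] in \<open>auto simp: T_def\<close>)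
  have fU: "(n, f) \<in> U" for n using f by blast
  have key: "\<phi> (n, s) = - \<phi> (- n, f)" if "(n, s) \<in> U" for n s
    using hom'[OF that fU[of "- n"]] closed[OF that fU[of "- n"]] zero by simp
  \<comment> \<open>The element \<open>f\<close> need not be idempotent: the product lies over
    \<open>f\<close> times \<open>f\<close>, but by \<open>key\<close> the value of
    \<open>\<phi>\<close> depends only on the first coordinate.\<close>
  have "\<phi> (m + n, f) = \<phi> (m, f) + \<phi> (n, f)" for m n
    using hom'[OF fU fU, of m n] key[OF closed[OF fU fU], of m n] key[OF fU, of "m + n"] by simp
  then have lin: "\<phi> (n, f) = \<phi> (1, f) * n" for n
    by (rule int_additive_eq_mult)
  show ?thesis
  proof (intro exI ballI)
    fix u assume "u \<in> U"
    then show "\<phi> u = \<phi> (1, f) * fst u"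
      using key[of "fst u" "snd u"] lin[of "- fst u"] by simp
  qed
qed

text \<open>The first coordinate of the isomorphism is a homomorphism to the integers, hence
  multiplication by some \<open>c\<close>. The isomorphism therefore carries the fibre over n onto
  the fibre over c n once \<open>c\<close> is a unit.\<close>

lemma subdirect_iso_card_fibre:
  assumes fin: "finite (carrier S)" and U: "U \<in> subdirect_products integer_group S"
    and V: "V \<in> subdirect_products integer_group S"
    and f: "UNIV \<times> {f} \<subseteq> U"
    and iso: "(integer_group \<times>\<times> S)\<lparr>carrier := U\<rparr> \<cong> (integer_group \<times>\<times> S)\<lparr>carrier := V\<rparr>"
  shows "\<exists>c::int. \<bar>c\<bar> = 1 \<and> (\<forall>n. card {s. (n, s) \<in> U} = card {s. (c * n, s) \<in> V})"
proof -
  obtain h where hom: "\<And>u v. \<lbrakk>u \<in> U; v \<in> U\<rbrakk> \<Longrightarrow>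
        h (u \<otimes>\<^bsub>integer_group \<times>\<times> S\<^esub> v) = h u \<otimes>\<^bsub>integer_group \<times>\<times> S\<^esub> h v"
    and bij: "bij_betw h U V"
    using iso by (auto simp: is_iso_def iso_def hom_def)
  have add: "fst (h (u \<otimes>\<^bsub>integer_group \<times>\<times> S\<^esub> v)) = fst (h u) + fst (h v)" if "u \<in> U" "v \<in> U" for u v
    using hom[OF that] by (simp add: mult_DirProd')
  then obtain c where c: "\<And>u. u \<in> U \<Longrightarrow> fst (h u) = c * fst u"
    using subdirect_int_hom_eq_mult_fst[OF fin U f, of "\<lambda>u. fst (h u)", OF add] by blast
  \<comment> \<open>Surjectivity of the projection of \<open>V\<close> makes \<open>c\<close> a
    divisor of 1.\<close>
  have "(1::int) \<in> fst ` V" using V by (simp add: subdirect_products_def)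
  then obtain u where "u \<in> U" "fst (h u) = 1"
    using bij by (auto simp: bij_betw_def)
  then have "c * fst u = 1" using c by simp
  then have c1: "\<bar>c\<bar> = 1" using zmult_eq_1_iff by fastforce
  have "card {s. (n, s) \<in> U} = card {s. (c * n, s) \<in> V}" for n
  proof (rule bij_betw_same_card[of "\<lambda>s. snd (h (n, s))"])
    have hn: "h (n, s) = (c * n, snd (h (n, s)))" if "(n, s) \<in> U" for s
      using c[OF that] by (simp add: prod_eq_iff)
    show "bij_betw (\<lambda>s. snd (h (n, s))) {s. (n, s) \<in> U} {s. (c * n, s) \<in> V}"
    proof (rule bij_betw_imageI)
      show "inj_on (\<lambda>s. snd (h (n, s))) {s. (n, s) \<in> U}"
      proof (rule inj_onI, clarify)
        fix s t assume st: "(n, s) \<in> U" "(n, t) \<in> U" "snd (h (n, s)) = snd (h (n, t))"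
        then have "h (n, s) = h (n, t)" using hn by metis
        then show "s = t" using bij st by (auto simp: bij_betw_def inj_on_def)
      qed
      show "(\<lambda>s. snd (h (n, s))) ` {s. (n, s) \<in> U} = {s. (c * n, s) \<in> V}"
      proof (intro equalityI subsetI)
        fix t assume "t \<in> (\<lambda>s. snd (h (n, s))) ` {s. (n, s) \<in> U}"
        then obtain s where s: "(n, s) \<in> U" "t = snd (h (n, s))" by blast
        then have "h (n, s) \<in> V" using bij by (auto simp: bij_betw_def)
        then show "t \<in> {s. (c * n, s) \<in> V}" using hn[OF s(1)] s(2) by simp
      next
        fix t assume "t \<in> {s. (c * n, s) \<in> V}"
        then obtain m s where ms: "(m, s) \<in> U" "h (m, s) = (c * n, t)"
          using bij by (fastforce simp: bij_betw_def)
        then have "c * m = c * n" using c[OF ms(1)] ms(2) by (metis fst_conv)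
        then have "m = n" using c1 by auto
        then show "t \<in> (\<lambda>s. snd (h (n, s))) ` {s. (n, s) \<in> U}" using ms by force
      qed
    qed
  qed
  then show ?thesis using c1 by blast
qed

section \<open>Non-regular semigroups\<close>

lemma nonregular_imp_uncountable_classes:
  assumes S: "semigroup_struct S" and fin: "finite (carrier S)"
    and nonreg: "\<not> regular_semigroup S"
  shows "uncountable (subdirect_products integer_group S // subdirect_iso_rel integer_group S)"
proof -
  interpret semigroup_struct S by (rule S)
  obtain I J where sub: "I \<subseteq> carrier S" "J \<subseteq> carrier S" and dj: "I \<inter> J = {}"
    and ne: "I \<noteq> {}" "J \<noteq> {}"
    and ideal: "\<forall>s\<in>I. \<forall>t\<in>carrier S. s \<otimes>\<^bsub>S\<^esub> t \<in> I \<and> t \<otimes>\<^bsub>S\<^esub> s \<in> I"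
    and JS: "\<forall>s\<in>J. \<forall>t\<in>carrier S. s \<otimes>\<^bsub>S\<^esub> t \<in> I \<union> J \<and> t \<otimes>\<^bsub>S\<^esub> s \<in> I \<union> J"
    and JJ: "\<forall>s\<in>J. \<forall>t\<in>J. s \<otimes>\<^bsub>S\<^esub> t \<in> I"
    by (rule nonregular_ideal[OF S fin nonreg], rule that)
  obtain f where f: "f \<in> I" using ne by blast
  \<comment> \<open>The shift by 1 keeps \<open>X A\<close> positive. This avoids 0, where the fibre
    of \<open>U A\<close> is all of \<open>S\<close>, and it controls the sign change below.\<close>
  define X where "X A = (\<lambda>n. int n + 1) ` A" for A
  define U where "U A = UNIV \<times> I \<union> X A \<times> J \<union> {0} \<times> carrier S" for A
  have subdirect: "U A \<in> subdirect_products integer_group S" for A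
  proof -
    have "u \<otimes>\<^bsub>integer_group \<times>\<times> S\<^esub> v \<in> U A" if "u \<in> U A" "v \<in> U A" for u v
    proof -
      obtain m s n t where uv: "u = (m, s)" "v = (n, t)" by (metis surj_pair)
      have cl: "s \<in> carrier S" "t \<in> carrier S" using that sub uv by (auto simp: U_def)
      have mem: "s \<in> I \<or> m \<in> X A \<and> s \<in> J \<or> m = 0" "t \<in> I \<or> n \<in> X A \<and> t \<in> J \<or> n = 0"
        using that uv by (auto simp: U_def)
      \<comment> \<open>A factor from \<open>I\<close>, or two from \<open>J\<close>, puts the
        product into \<open>I\<close>, where every integer is allowed. A factor over 0 leaves the
        other integer unchanged, so the product of it with an element over \<open>J\<close> stays in
        the same fibre.\<close>
      consider "s \<in> I \<or> t \<in> I" | "s \<in> J" "t \<in> J" | "m \<in> X A" "s \<in> J" "n = 0"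
        | "m = 0" "n \<in> X A" "t \<in> J" | "m = 0" "n = 0"
        using mem by blast
      then have "(m + n, s \<otimes>\<^bsub>S\<^esub> t) \<in> U A"
        using ideal JS JJ cl by cases (auto simp: U_def)
      then show ?thesis by (simp add: uv)
    qed
    moreover have "fst ` U A = UNIV" using f by (force simp: U_def)
    moreover have "snd ` U A = carrier S"
    proof
      show "carrier S \<subseteq> snd ` U A" by (force simp: U_def)
    qed (use sub in \<open>auto simp: U_def\<close>)
    ultimately show ?thesis
      using sub by (auto simp: subdirect_products_def subsemigroup_def U_def)
  qed
  \<comment> \<open>Over nonzero n the fibre is either \<open>I\<close> or the strictly larger union
    of \<open>I\<close> and \<open>J\<close>, so its size detects membership in
    \<open>X A\<close>.\<close>
  have card_fibre: "card {s. (n, s) \<in> U A} > card I \<longleftrightarrow> n \<in> X A" if "n \<noteq> 0" for n A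
  proof (cases "n \<in> X A")
    case True
    then have "{s. (n, s) \<in> U A} = I \<union> J" using that by (auto simp: U_def)
    moreover have "finite I" "finite J" using sub fin finite_subset by blast+
    ultimately show ?thesis using True dj ne by (simp add: card_Un_disjoint card_gt_0_iff)
  next
    case False
    then have "{s. (n, s) \<in> U A} = I" using that by (auto simp: U_def)
    then show ?thesis using False by simp
  qed
  have inj: "A = B" if rel: "(U A, U B) \<in> subdirect_iso_rel integer_group S" for A B
  proof -
    have iso: "(integer_group \<times>\<times> S)\<lparr>carrier := U A\<rparr> \<cong> (integer_group \<times>\<times> S)\<lparr>carrier := U B\<rparr>"
      using rel by (simp add: subdirect_iso_rel_def)
    have fU: "UNIV \<times> {f} \<subseteq> U A" using f by (auto simp: U_def)
    obtain c :: int where c: "\<bar>c\<bar> = 1"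
      and card: "\<And>n. card {s. (n, s) \<in> U A} = card {s. (c * n, s) \<in> U B}"
      using subdirect_iso_card_fibre[OF fin subdirect subdirect fU iso] by blast
    have X: "n \<in> X A \<longleftrightarrow> c * n \<in> X B" if "n \<noteq> 0" for n
      using card_fibre[OF that, of A] card_fibre[of "c * n" B] card[of n] c that by auto
    have mem: "k \<in> C \<longleftrightarrow> int k + 1 \<in> X C" for k C by (auto simp: X_def)
    have pos: "n > 0" if "n \<in> X C" for n C using that by (auto simp: X_def)
    consider "c = 1" | "c = -1" using c by linarith
    then show ?thesis
    proof cases
      case 1
      then show ?thesis using X[of "int k + 1" for k] by (auto simp: mem)
    next
      \<comment> \<open>A sign change would match positive integers with negative ones, so both sets
        must be empty.\<close>
      case 2
      have "k \<notin> A" for k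
        using X[of "int k + 1"] pos[of "c * (int k + 1)" B] 2 by (auto simp: mem)
      moreover have "k \<notin> B" for k
        using X[of "- (int k + 1)"] pos[of "- (int k + 1)" A] 2 by (auto simp: mem add.commute)
      ultimately show ?thesis by blast
    qed
  qed
  let ?R = "subdirect_iso_rel integer_group S"
  show ?thesis
  proof
    assume "countable (subdirect_products integer_group S // ?R)"
    moreover have "(\<lambda>A. ?R `` {U A}) ` UNIV \<subseteq> subdirect_products integer_group S // ?R"
      using subdirect by (auto intro: quotientI)
    ultimately have "countable (range (\<lambda>A. ?R `` {U A}))" using countable_subset by blast
    moreover have "inj (\<lambda>A. ?R `` {U A})"
      using inj eq_equiv_class[OF _ equiv_subdirect_iso_rel subdirect] by (intro injI) blast
    ultimately have "countable (UNIV :: nat set set)" using countable_image_inj_on by blast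
    then obtain g :: "nat \<Rightarrow> nat set" where "range g = UNIV"
      using range_from_nat_into by blast
    then show False using Cantors_theorem[of UNIV] by (metis Pow_UNIV)
  qed
qed

theorem mainTheorem1:
  fixes S :: "('a, 'b) monoid_scheme"
  assumes "semigroup_struct S" and "finite (carrier S)"
  shows "(regular_semigroup S \<longleftrightarrow> countable (subdirect_products integer_group S)) \<and>
         (countable (subdirect_products integer_group S) \<longleftrightarrow>
            countable (subdirect_products integer_group S // subdirect_iso_rel integer_group S))"
proof -
  \<comment> \<open>Classes are an image of the subdirect products, so (ii) implies (iii). The cycle
    closes by the contrapositive of (iii) implies (i).\<close>
  have "countable (subdirect_products integer_group S // subdirect_iso_rel integer_group S)"
    if "countable (subdirect_products integer_group S)"
  proof -
    have "subdirect_products integer_group S // subdirect_iso_rel integer_group S =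
        (\<lambda>U. subdirect_iso_rel integer_group S `` {U}) ` subdirect_products integer_group S"
      by (auto simp: quotient_def)
    then show ?thesis using that by simp
  qed
  then show ?thesis
    using assms regular_imp_countable_subdirect_products nonregular_imp_uncountable_classes by blast
qed

end
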